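(* There exist a $CW(126,8^2)$ and a $CW(198,10^2)$. That is, there is a circulant matrix $W\in\{0,\pm1\}^{126\times126}$ with $WW^T=64\,I$, and there is a circulant matrix $W'\in\{0,\pm1\}^{198\times198}$ with $W'W'^T=100\,I$.
   Context: A matrix in $\mathbb{R}^{n\times n}$ is circulant if there is a vector $w=(w_0,\dots,w_{n-1})\in\mathbb{R}^n$ such that its rows are the cyclic permutations of $w$ offset by their row index, i.e. (with rows and columns indexed by $0,\dots,n-1$) its $(i,j)$ entry is $w_{(j-i)\bmod n}$. For $n,k\in\mathbb{N}$, a circulant weighing matrix $CW(n,k^2)$ is a circulant matrix $W\in\{0,\pm1\}^{n\times n}$ such that $WW^T=k^2I$, where $I$ is the $n\times n$ identity matrix. *)

theory Defs
  imports "Jordan_Normal_Form.Matrix" "HOL.Real"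
begin

text \<open>The index is computed in the integers: subtraction on natural numbers truncates at zero.\<close>

definition circulant_mat :: "nat \<Rightarrow> real mat \<Rightarrow> bool" where
  "circulant_mat n W \<longleftrightarrow> W \<in> carrier_mat n n \<and>
     (\<exists>w \<in> carrier_vec n. \<forall>i<n. \<forall>j<n. W $$ (i, j) = w $ nat ((int j - int i) mod int n))"

text \<open>\<open>is_CW n k W\<close> says that \<open>W\<close> is a $CW(n,k^2)$; the second parameter is \<open>k\<close>, not
  the weight \<open>k\<^sup>2\<close>.\<close>

definition is_CW :: "nat \<Rightarrow> nat \<Rightarrow> real mat \<Rightarrow> bool" where
  "is_CW n k W \<longleftrightarrow> circulant_mat n W \<and> elements_mat W \<subseteq> {0, 1, -1} \<and>
     W * transpose_mat W = (real k)\<^sup>2 \<cdot>\<^sub>m 1\<^sub>m n"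

end

theory Submission
  imports Defs
begin

text \<open>
  Identify a circulant matrix with the element $w = \sum_i w_i x^i$ of the group ring
  $\mathbb{Z}[C_n]$, where $C_n = \langle x\rangle$; the matrix is a $CW(n,k^2)$ exactly when $w$ has
  coefficients in $\{0,\pm1\}$ and $w w^* = k^2$, where $*$ inverts group elements.  Writing
  $126 = 6 \cdot 21$ and $198 = 6 \cdot 33$, both matrices come from one product.

  For odd $n$ and $s \ge 2$ put $N = 2sn$, $t = x^{N/2}$ and $b = (1 + t) + x (1 - t)$ in
  $\mathbb{Z}[C_N]$.  Since $t^2 = 1$, the elements $1 + t$ and $1 - t$ annihilate each other and
  $(1 + t)^2 + (1 - t)^2 = 4$, so $b b^* = 4$.  Given a $CW(n,k^2)$ with element $a$, replace $x$ in
  it by $x^{2s}$.  This embeds it in the subgroup of order $n$, and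
  $a(x^{2s})\, b$ satisfies $w w^* = 4k^2$.  Its coefficients stay in $\{0,\pm1\}$ because the
  four terms of $b$ lie in distinct cosets of that subgroup: their exponents
  $0, 1, sn, sn + 1$ are congruent to $0, 1, s, s + 1$ modulo $2s$, as $n$ is odd.  Hence a
  $CW(n,k^2)$ yields a $CW(2sn,(2k)^2)$ (\<open>CW_seq_double\<close>, a case of the composition
  \<open>CW_seq_compose\<close>).

  With $s = 3$ it remains to exhibit a $CW(21,4^2)$ and a $CW(33,5^2)$.  Requiring
  the coefficients to be constant on the orbits of a multiplier, $2$ modulo $21$ and $5$ modulo $33$,
  leaves six free values in each case, and suitable choices exist.
\<close>

section \<open>Circulant weighing matrices as periodic sequences\<close>

text \<open>Sequences are indexed by all integers, so that the autocorrelation can be taken at any shift;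
  its vanishing away from multiples of the period is the orthogonality of distinct rows.\<close>

definition CW_seq :: "nat \<Rightarrow> real \<Rightarrow> (int \<Rightarrow> real) \<Rightarrow> bool" where
  "CW_seq n k f \<longleftrightarrow> n > 0 \<and> (\<forall>i. f i \<in> {0, 1, -1}) \<and> (\<forall>i. f (i mod int n) = f i) \<and>
     (\<forall>d. (\<Sum>i\<in>{0..<int n}. f i * f (i + d)) = (if int n dvd d then k\<^sup>2 else 0))"

lemma CW_seqD:
  assumes "CW_seq n k f"
  shows "n > 0" "f i \<in> {0, 1, -1}" "f (i mod int n) = f i"
    "(\<Sum>i\<in>{0..<int n}. f i * f (i + d)) = (if int n dvd d then k\<^sup>2 else 0)"
  using assms unfolding CW_seq_def by blast+

text \<open>The map $u \mapsto mu + \beta$ is a bijection from the integers modulo $n$ to the residues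
  modulo $mn$ that are congruent to $\beta$ modulo $m$.  For $m = 1$ this is shift invariance of the
  sum over a period.\<close>

lemma sum_over_residue_class:
  fixes G :: "int \<Rightarrow> 'a::comm_monoid_add" and m n \<beta> :: int
  assumes m: "m > 0" and n: "n > 0" and per: "\<And>i. G (i mod (m * n)) = G i"
  shows "(\<Sum>j\<in>{j\<in>{0..<m * n}. m dvd j - \<beta>}. G j) = (\<Sum>u\<in>{0..<n}. G (m * u + \<beta>))"
proof (rule sum.reindex_bij_witness[where i = "\<lambda>u. (m * u + \<beta>) mod (m * n)"
        and j = "\<lambda>j. ((j - \<beta>) div m) mod n"])
  fix j assume j: "j \<in> {j\<in>{0..<m * n}. m dvd j - \<beta>}"
  then have "m dvd j - \<beta>" by simp
  then obtain q where "j - \<beta> = m * q" by (rule dvdE)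
  then have q: "j = m * q + \<beta>" by simp
  have *: "(m * (q mod n) + \<beta>) mod (m * n) = (m * q + \<beta>) mod (m * n)"
    unfolding mult_mod_right by (rule mod_add_left_eq)
  show "(m * ((j - \<beta>) div m mod n) + \<beta>) mod (m * n) = j"
    using j m unfolding q by (simp add: *)
  show "G (m * ((j - \<beta>) div m mod n) + \<beta>) = G j"
    using per[of "m * (q mod n) + \<beta>"] per[of "m * q + \<beta>"] m unfolding q by (simp add: *)
  show "(j - \<beta>) div m mod n \<in> {0..<n}" using n by simp
next
  fix u assume u: "u \<in> {0..<n}"
  define r where "r = (m * u + \<beta>) div (m * n)"
  have r: "(m * u + \<beta>) mod (m * n) = m * (u - n * r) + \<beta>"
    unfolding r_def by (simp add: algebra_simps minus_mult_div_eq_mod[symmetric])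
  have "(u - n * r) mod n = u mod n"
    using mod_mult_self2[of "u - n * r" n r] by simp
  then show "((m * u + \<beta>) mod (m * n) - \<beta>) div m mod n = u"
    using u m by (simp add: r)
  show "(m * u + \<beta>) mod (m * n) \<in> {j\<in>{0..<m * n}. m dvd j - \<beta>}"
    using r pos_mod_bound[of "m * n" "m * u + \<beta>"] pos_mod_sign[of "m * n" "m * u + \<beta>"] m n by simp
qed

lemma CW_of_CW_seq:
  assumes f: "CW_seq n (real k) f"
  shows "is_CW n k (mat n n (\<lambda>(i, j). f (int j - int i)))" (is "is_CW n k ?W")
proof -
  note n = CW_seqD(1)[OF f] and per = CW_seqD(3)[OF f]
  have "circulant_mat n ?W"
    unfolding circulant_mat_def
  proof (intro conjI bexI[where x = "vec n (\<lambda>i. f (int i))"] allI impI)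
    fix i j assume "i < n" "j < n"
    moreover have "nat ((int j - int i) mod int n) < n"
      using n by (simp add: nat_less_iff)
    ultimately show "?W $$ (i, j) = vec n (\<lambda>i. f (int i)) $ nat ((int j - int i) mod int n)"
      using n by (simp add: per)
  qed auto
  moreover have "elements_mat ?W \<subseteq> {0, 1, -1}"
    unfolding elements_mat_def using CW_seqD(2)[OF f] by auto
  moreover have "?W * transpose_mat ?W = (real k)\<^sup>2 \<cdot>\<^sub>m 1\<^sub>m n"
  proof (rule eq_matI)
    fix i i' assume "i < dim_row ((real k)\<^sup>2 \<cdot>\<^sub>m 1\<^sub>m n)" "i' < dim_col ((real k)\<^sup>2 \<cdot>\<^sub>m 1\<^sub>m n)"
    then have i: "i < n" "i' < n" by auto
    let ?G = "\<lambda>j. f (j - int i) * f (j - int i')"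
    have "(?W * transpose_mat ?W) $$ (i, i') = (\<Sum>j\<in>{0..<n}. ?G (int j))"
      using i by (simp add: scalar_prod_def)
    also have "\<dots> = (\<Sum>j\<in>{0..<int n}. ?G j)"
      by (rule sum.reindex_bij_witness[where i = nat and j = int]) auto
    also have "\<dots> = (\<Sum>j\<in>{j\<in>{0..<1 * int n}. 1 dvd j - int i}. ?G j)"
      by (rule sum.cong) auto
    also have "\<dots> = (\<Sum>u\<in>{0..<int n}. ?G (1 * u + int i))"
    proof (rule sum_over_residue_class)
      fix j
      show "?G (j mod (1 * int n)) = ?G j"
        by (metis mod_diff_left_eq mult_1 per)
    qed (use n in auto)
    also have "\<dots> = (\<Sum>u\<in>{0..<int n}. f u * f (u + (int i - int i')))"
      by (simp add: algebra_simps)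
    also have "\<dots> = (if int n dvd int i - int i' then (real k)\<^sup>2 else 0)"
      by (rule CW_seqD(4)[OF f])
    also have "int n dvd int i - int i' \<longleftrightarrow> i = i'"
      using i by (auto dest!: zdvd_imp_le[rotated] simp: dvd_diff_commute)
        (metis of_nat_eq_iff mod_eq_dvd_iff zmod_int mod_less)
    also have "(if i = i' then (real k)\<^sup>2 else 0) = ((real k)\<^sup>2 \<cdot>\<^sub>m 1\<^sub>m n) $$ (i, i')"
      using i by simp
    finally show "(?W * transpose_mat ?W) $$ (i, i') = ((real k)\<^sup>2 \<cdot>\<^sub>m 1\<^sub>m n) $$ (i, i')" .
  qed auto
  ultimately show ?thesis unfolding is_CW_def by blast
qed

section \<open>Composition along the cosets of a subgroup\<close>

text \<open>The sequence below is the element $a(x^m)\, b$ of $\mathbb{Z}[C_{mn}]$, where $b$ is supported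
  on \<open>T\<close>.  Injectivity modulo $m$ places the translates of $a(x^m)$ by the
  elements of \<open>T\<close> in distinct cosets, so at most one of the summands is nonzero and the entries stay
  in $\{0,\pm1\}$.  The autocorrelation is that of $b$ times $k^2$: a pair
  $(\beta,\gamma)$ for which $m$ divides $e = \beta + d - \gamma$ contributes $b_\beta b_\gamma$ times
  the autocorrelation of $a$ at $e/m$, which is $k^2$ if $mn$ divides $e$ and $0$ otherwise; the
  other pairs contribute nothing.\<close>

lemma CW_seq_compose:
  fixes T :: "int set" and b :: "int \<Rightarrow> real" and m n :: nat
  assumes a: "CW_seq n k a" and m: "m > 0" and T: "finite T"
    and inj: "inj_on (\<lambda>\<beta>. \<beta> mod int m) T"
    and b: "\<And>\<beta>. b \<beta> \<in> {0, 1, -1}"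
    and b_corr: "\<And>d. (\<Sum>\<beta>\<in>T. \<Sum>\<gamma>\<in>T. b \<beta> * b \<gamma> * of_bool (int (m * n) dvd \<beta> + d - \<gamma>))
      = (if int (m * n) dvd d then l\<^sup>2 else 0)"
  shows "CW_seq (m * n) (k * l)
    (\<lambda>j. \<Sum>\<beta>\<in>T. if int m dvd j - \<beta> then b \<beta> * a ((j - \<beta>) div int m) else 0)" (is "CW_seq _ _ ?c")
  unfolding CW_seq_def
proof (intro conjI allI)
  let ?M = "int m" and ?N = "int m * int n"
  note n = CW_seqD(1)[OF a] and per = CW_seqD(3)[OF a]
  show "0 < m * n" using m n by simp
  show "?c j \<in> {0, 1, -1}" for j
  proof (cases "\<exists>\<beta>\<in>T. ?M dvd j - \<beta>")
    case True
    then obtain \<beta> where \<beta>: "\<beta> \<in> T" "?M dvd j - \<beta>" by blast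
    have "?M dvd j - \<gamma> \<longleftrightarrow> \<gamma> = \<beta>" if "\<gamma> \<in> T" for \<gamma>
      using inj \<beta> that by (metis inj_onD mod_eq_dvd_iff)
    then have "?c j = (\<Sum>\<gamma>\<in>T. if \<gamma> = \<beta> then b \<beta> * a ((j - \<beta>) div ?M) else 0)"
      by (intro sum.cong) (simp_all cong: if_cong)
    also have "\<dots> = b \<beta> * a ((j - \<beta>) div ?M)"
      using \<beta> T by simp
    finally show ?thesis
      using b[of \<beta>] CW_seqD(2)[OF a, of "(j - \<beta>) div ?M"] by auto
  next
    case False
    then have "?c j = (\<Sum>\<gamma>\<in>T. 0)" by (intro sum.cong) auto
    then show ?thesis by simp
  qed
  have a_shift: "a (x - int n * q) = a x" for x q
    using per[of "x - int n * q"] per[of x] mod_mult_self2[of "x - int n * q" "int n" q] by simp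
  have lift_per: "a ((j mod ?N - \<beta>) div ?M) = a ((j - \<beta>) div ?M)"
    and class_per: "?M dvd j mod ?N - \<beta> \<longleftrightarrow> ?M dvd j - \<beta>" for j \<beta>
  proof -
    define q where "q = j div ?N"
    have e: "j mod ?N - \<beta> = j - \<beta> + ?M * (- int n * q)"
      unfolding q_def by (simp add: minus_mult_div_eq_mod[symmetric])
    show "?M dvd j mod ?N - \<beta> \<longleftrightarrow> ?M dvd j - \<beta>"
      unfolding e by (rule dvd_add_times_triv_right_iff[of ?M "j - \<beta>", unfolded mult.commute[of _ ?M]])
    have "(j mod ?N - \<beta>) div ?M = (j - \<beta>) div ?M - int n * q"
      unfolding e using m by (subst div_mult_self2) auto
    then show "a ((j mod ?N - \<beta>) div ?M) = a ((j - \<beta>) div ?M)"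
      using a_shift by simp
  qed
  have c_per: "?c (j mod ?N) = ?c j" for j
    by (simp only: lift_per class_per)
  then show "?c (j mod int (m * n)) = ?c j" for j by (simp only: of_nat_mult)
  fix d
  \<comment> \<open>An opaque name keeps the second factor folded while the first one is expanded over \<open>T\<close>.\<close>
  define C where "C = ?c"
  have shift: "C (j mod ?N + d) = C (j + d)" for j
    using c_per[of "j mod ?N + d"] c_per[of "j + d"] unfolding C_def by (simp only: mod_add_left_eq)
  have inner: "(\<Sum>u\<in>{0..<int n}. a u * C (?M * u + \<beta> + d))
      = k\<^sup>2 * (\<Sum>\<gamma>\<in>T. b \<gamma> * of_bool (?N dvd \<beta> + d - \<gamma>))" for \<beta>
  proof -
    have "C (?M * u + \<beta> + d) = (\<Sum>\<gamma>\<in>T. if ?M dvd \<beta> + d - \<gamma> then b \<gamma> * a (u + (\<beta> + d - \<gamma>) div ?M) else 0)" for u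
      unfolding C_def
    proof (rule sum.cong)
      fix \<gamma>
      have e: "?M * u + \<beta> + d - \<gamma> = \<beta> + d - \<gamma> + ?M * u" by simp
      have d: "?M dvd ?M * u + \<beta> + d - \<gamma> \<longleftrightarrow> ?M dvd \<beta> + d - \<gamma>"
        unfolding e by (rule dvd_add_times_triv_right_iff[of ?M "\<beta> + d - \<gamma>", unfolded mult.commute[of _ ?M]])
      have "(?M * u + \<beta> + d - \<gamma>) div ?M = u + (\<beta> + d - \<gamma>) div ?M"
        unfolding e using m by (subst div_mult_self2) auto
      then show "(if ?M dvd ?M * u + \<beta> + d - \<gamma> then b \<gamma> * a ((?M * u + \<beta> + d - \<gamma>) div ?M) else 0)
        = (if ?M dvd \<beta> + d - \<gamma> then b \<gamma> * a (u + (\<beta> + d - \<gamma>) div ?M) else 0)"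
        by (simp only: d)
    qed simp
    then have "(\<Sum>u\<in>{0..<int n}. a u * C (?M * u + \<beta> + d))
      = (\<Sum>u\<in>{0..<int n}. \<Sum>\<gamma>\<in>T. of_bool (?M dvd \<beta> + d - \<gamma>) * b \<gamma> * (a u * a (u + (\<beta> + d - \<gamma>) div ?M)))"
      by (auto simp: sum_distrib_left intro!: sum.cong)
    also have "\<dots> = (\<Sum>\<gamma>\<in>T. of_bool (?M dvd \<beta> + d - \<gamma>) * b \<gamma> *
        (\<Sum>u\<in>{0..<int n}. a u * a (u + (\<beta> + d - \<gamma>) div ?M)))"
      by (subst sum.swap) (simp add: sum_distrib_left)
    also have "\<dots> = (\<Sum>\<gamma>\<in>T. k\<^sup>2 * (b \<gamma> * of_bool (?N dvd \<beta> + d - \<gamma>)))"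
    proof (rule sum.cong)
      fix \<gamma>
      have "?N dvd x \<longleftrightarrow> ?M dvd x \<and> int n dvd x div ?M" for x
        using m by (metis dvd_mult_left dvd_div_iff_mult dvd_mult_imp_div of_nat_0_less_iff less_irrefl mult.commute)
      then show "of_bool (?M dvd \<beta> + d - \<gamma>) * b \<gamma> *
        (\<Sum>u\<in>{0..<int n}. a u * a (u + (\<beta> + d - \<gamma>) div ?M)) = k\<^sup>2 * (b \<gamma> * of_bool (?N dvd \<beta> + d - \<gamma>))"
        by (simp add: CW_seqD(4)[OF a])
    qed simp
    finally show ?thesis by (simp add: sum_distrib_left)
  qed
  have "(\<Sum>j\<in>{0..<?N}. C j * C (j + d))
    = (\<Sum>j\<in>{0..<?N}. \<Sum>\<beta>\<in>T. if ?M dvd j - \<beta> then b \<beta> * a ((j - \<beta>) div ?M) * C (j + d) else 0)"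
    by (subst C_def) (auto simp: sum_distrib_right intro!: sum.cong)
  also have "\<dots> = (\<Sum>\<beta>\<in>T. \<Sum>j\<in>{j\<in>{0..<?N}. ?M dvd j - \<beta>}. b \<beta> * a ((j - \<beta>) div ?M) * C (j + d))"
    by (subst sum.swap, intro sum.cong refl sum.inter_filter[symmetric]) simp
  also have "\<dots> = (\<Sum>\<beta>\<in>T. \<Sum>u\<in>{0..<int n}. b \<beta> * a ((?M * u + \<beta> - \<beta>) div ?M) * C (?M * u + \<beta> + d))"
  proof (rule sum.cong[OF refl], rule sum_over_residue_class)
    fix \<beta> j
    show "b \<beta> * a ((j mod ?N - \<beta>) div ?M) * C (j mod ?N + d)
      = b \<beta> * a ((j - \<beta>) div ?M) * C (j + d)"
      by (simp only: shift lift_per)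
  qed (use m n in auto)
  also have "\<dots> = (\<Sum>\<beta>\<in>T. b \<beta> * (\<Sum>u\<in>{0..<int n}. a u * C (?M * u + \<beta> + d)))"
    using m by (simp add: sum_distrib_left mult.assoc)
  also have "\<dots> = k\<^sup>2 * (\<Sum>\<beta>\<in>T. \<Sum>\<gamma>\<in>T. b \<beta> * b \<gamma> * of_bool (?N dvd \<beta> + d - \<gamma>))"
    by (simp only: inner sum_distrib_left) (simp add: mult_ac)
  also have "\<dots> = (if int (m * n) dvd d then (k * l)\<^sup>2 else 0)"
    using b_corr[of d] by (simp add: power_mult_distrib)
  finally show "(\<Sum>j\<in>{0..<int (m * n)}. ?c j * ?c (j + d)) = (if int (m * n) dvd d then (k * l)\<^sup>2 else 0)"
    by (simp add: C_def)
qed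

text \<open>The composition with $b = 1 + x + x^h - x^{h+1}$, where $h = sn$ is half of the new period.\<close>

lemma CW_seq_double:
  assumes a: "CW_seq n k a" and n: "odd n" and s: "s \<ge> 2"
  shows "\<exists>f. CW_seq (2 * s * n) (k * 2) f"
proof -
  define h where "h = int (s * n)"
  define N where "N = int (2 * s * n)"
  have N: "N = h + h" unfolding N_def h_def by simp
  have n0: "n > 0" using n odd_pos by blast
  have h2: "h \<ge> 2" unfolding h_def using n0 s
    using mult_le_mono[of 2 s 1 n] by linarith
  define b :: "int \<Rightarrow> real" where "b = (\<lambda>\<beta>. if \<beta> = h + 1 then -1 else 1)"
  let ?T = "{0, 1, h, h + 1}"
  have hmod: "h mod int (2 * s) = int s"
  proof -
    obtain t where "n = 2 * t + 1" using n oddE by blast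
    then have "h = int s + int (2 * s) * int t" unfolding h_def by (simp add: algebra_simps)
    then show ?thesis using s by simp
  qed
  have h1mod: "(h + 1) mod int (2 * s) = int s + 1"
    using hmod s mod_add_left_eq[of h "int (2 * s)" 1] by simp
  have "CW_seq (2 * s * n) (k * 2)
    (\<lambda>j. \<Sum>\<beta>\<in>?T. if int (2 * s) dvd j - \<beta> then b \<beta> * a ((j - \<beta>) div int (2 * s)) else 0)"
  proof (rule CW_seq_compose[OF a])
    show "inj_on (\<lambda>\<beta>. \<beta> mod int (2 * s)) ?T"
      using s hmod h1mod by (auto simp: inj_on_def)
    fix d
    define D :: "int \<Rightarrow> real" where "D x = of_bool (N dvd x)" for x
    have wrap: "D (x + h) = D (x - h)" for x
    proof -
      have "x + h = x - h + N" by (simp add: N)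
      then show ?thesis unfolding D_def by (simp only: dvd_add_triv_right_iff)
    qed
    \<comment> \<open>The off-diagonal terms cancel in pairs of opposite sign, whose shifts are equal or of the
      form $e + h$ and $e - h$, hence congruent modulo the period.\<close>
    have "(\<Sum>\<beta>\<in>?T. \<Sum>\<gamma>\<in>?T. b \<beta> * b \<gamma> * D (\<beta> + d - \<gamma>)) = 4 * D d"
      using h2 wrap[of d] wrap[of "d + 1"] wrap[of "d - 1"]
      by (simp add: b_def algebra_simps)
    then have "(\<Sum>\<beta>\<in>?T. \<Sum>\<gamma>\<in>?T. b \<beta> * b \<gamma> * of_bool (N dvd \<beta> + d - \<gamma>)) = (if N dvd d then 2\<^sup>2 else 0)"
      unfolding D_def by (simp only: of_bool_def split: if_split) simp
    then show "(\<Sum>\<beta>\<in>?T. \<Sum>\<gamma>\<in>?T. b \<beta> * b \<gamma> * of_bool (int (2 * s * n) dvd \<beta> + d - \<gamma>))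
      = (if int (2 * s * n) dvd d then 2\<^sup>2 else 0)"
      unfolding N_def .
  qed (use s in \<open>auto simp: b_def\<close>)
  then show ?thesis by blast
qed

section \<open>Two small circulant weighing matrices\<close>

text \<open>Reduces the autocorrelation condition at all integer shifts to a finite computation with
  integer lists.\<close>

lemma CW_seq_of_list:
  fixes xs :: "int list"
  assumes "xs \<noteq> []" and vals: "set xs \<subseteq> {0, 1, -1}"
    and corr: "\<forall>d\<in>set [0..<length xs].
      sum_list (map2 (*) xs (rotate d xs)) = (if d = 0 then k\<^sup>2 else 0)"
  shows "CW_seq (length xs) (real_of_int k) (\<lambda>i. real_of_int (xs ! nat (i mod int (length xs))))"
    (is "CW_seq ?n _ ?f")
  unfolding CW_seq_def
proof (intro conjI allI)
  show n: "?n > 0" using assms(1) by simp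
  show "?f i \<in> {0, 1, -1}" for i
  proof -
    have "nat (i mod int ?n) < ?n" using n by (simp add: nat_less_iff)
    then have "xs ! nat (i mod int ?n) \<in> {0, 1, -1}" using vals nth_mem by blast
    then show ?thesis by auto
  qed
  show "?f (i mod int ?n) = ?f i" for i by simp
  fix d
  define e where "e = nat (d mod int ?n)"
  have e: "e < ?n" "int e = d mod int ?n" using n by (auto simp: e_def nat_less_iff)
  have "(\<Sum>i\<in>{0..<int ?n}. ?f i * ?f (i + d)) = (\<Sum>i\<in>{0..<?n}. ?f (int i) * ?f (int i + d))"
    by (rule sum.reindex_bij_witness[where i = int and j = nat]) auto
  also have "\<dots> = (\<Sum>i\<in>{0..<?n}. real_of_int (xs ! i * rotate e xs ! i))"
  proof (rule sum.cong)
    fix i assume i: "i \<in> {0..<?n}"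
    have "nat ((int i + d) mod int ?n) = (e + i) mod ?n"
      by (metis add.commute e(2) mod_add_right_eq nat_int of_nat_add zmod_int)
    then show "?f (int i) * ?f (int i + d) = real_of_int (xs ! i * rotate e xs ! i)"
      using i by (simp add: nth_rotate)
  qed simp
  also have "\<dots> = real_of_int (sum_list (map2 (*) xs (rotate e xs)))"
    by (simp add: sum_list_sum_nth)
  also have "\<dots> = (if e = 0 then (real_of_int k)\<^sup>2 else 0)"
    using corr e(1) by auto
  also have "e = 0 \<longleftrightarrow> int ?n dvd d"
    using e(2) by (metis dvd_eq_mod_eq_0 of_nat_eq_0_iff)
  finally show "(\<Sum>i\<in>{0..<int ?n}. ?f i * ?f (i + d)) = (if int ?n dvd d then (real_of_int k)\<^sup>2 else 0)" .
qed

text \<open>The orbits of multiplication by $2$ modulo $21$ have the representatives $0, 1, 3, 5, 7, 9$.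
  The sequence is $1$ on the orbits of $0$, $5$ and $9$, of sizes $1$, $6$ and $3$, and $-1$ on the
  orbit of $1$, of size $6$.\<close>

lemma CW_seq_21_16: "\<exists>f. CW_seq 21 4 f"
proof -
  define xs :: "int list" where
    "xs = [1, -1, -1, 0, -1, 1, 0, 0, -1, 1, 1, -1, 0, 1, 0, 1, -1, 1, 1, 1, 1]"
  have "xs \<noteq> []" "set xs \<subseteq> {0, 1, -1}"
    by (simp_all add: xs_def)
  moreover have "\<forall>d\<in>set [0..<length xs].
      sum_list (map2 (*) xs (rotate d xs)) = (if d = 0 then 4\<^sup>2 else 0)"
    unfolding xs_def by code_simp
  moreover have "length xs = 21"
    by (simp add: xs_def)
  ultimately show ?thesis
    using CW_seq_of_list[of xs 4] by auto
qed

text \<open>The orbits of multiplication by $5$ modulo $33$ have the representatives $0, 1, 2, 3, 6, 11$.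
  The sequence is $1$ on the orbits of $1$ and $6$, of sizes $10$ and $5$, and $-1$ on the orbit
  of $2$, of size $10$.\<close>

lemma CW_seq_33_25: "\<exists>f. CW_seq 33 5 f"
proof -
  define xs :: "int list" where
    "xs = [0, 1, -1, 0, 1, 1, 1, -1, -1, 0, -1, 0, 0, -1, 1, 0, 1, -1, 1, -1, 1, 1, 0, 1, 1, 1, 1,
      0, -1, -1, 1, 1, -1]"
  have "xs \<noteq> []" "set xs \<subseteq> {0, 1, -1}"
    by (simp_all add: xs_def)
  moreover have "\<forall>d\<in>set [0..<length xs].
      sum_list (map2 (*) xs (rotate d xs)) = (if d = 0 then 5\<^sup>2 else 0)"
    unfolding xs_def by code_simp
  moreover have "length xs = 33"
    by (simp add: xs_def)
  ultimately show ?thesis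
    using CW_seq_of_list[of xs 5] by auto
qed

section \<open>Orders 126 and 198\<close>

theorem theorem4p3:
  shows "(\<exists>W. is_CW 126 8 W) \<and> (\<exists>W'. is_CW 198 10 W')"
proof
  obtain a where "CW_seq 21 4 a" using CW_seq_21_16 ..
  then obtain f where "CW_seq 126 (real 8) f"
    using CW_seq_double[of 21 4 a 3] by auto
  then show "\<exists>W. is_CW 126 8 W" using CW_of_CW_seq by blast
next
  obtain a where "CW_seq 33 5 a" using CW_seq_33_25 ..
  then obtain f where "CW_seq 198 (real 10) f"
    using CW_seq_double[of 33 5 a 3] by auto
  then show "\<exists>W'. is_CW 198 10 W'" using CW_of_CW_seq by blast
qed

end
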